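(* Let $0<q<1$, let $n\ge 1$, and let $W_n=\{x\in\mathbb{Z}^n : x_1\le\dots\le x_n\}$. If $x=(x_1,\dots,x_n)$ and $y=(y_1,\dots,y_n)$ are elements of $W_n$, then for integers $m\ge \ell\ge 0$, $$\mathbb{P}[\mathbf{G}(m)=y\,|\,\mathbf{G}(\ell)=x]=\det\big((\Delta^{j-i}w_{m-\ell})(y_j-x_i)\big)_{1\le i,j\le n}.$$
   Context: Last-passage times: let $w(i,j)$, $i,j\ge 1$ integers, be independent geometric random variables with $\mathbb{P}[w(i,j)=k]=(1-q)q^k$ for $k=0,1,2,\dots$. For $m,n\ge 1$ set $G(m,n)=\max_\pi\sum_{(i,j)\in\pi}w(i,j)$, the maximum being over all up/right lattice paths $\pi$ from $(1,1)$ to $(m,n)$. These satisfy $G(m,n)=\max(G(m-1,n),G(m,n-1))+w(m,n)$ with $G(0,n)=G(n,0)=0$ for $n\ge1$. For fixed $n$, $\mathbf{G}(i)=(G(i,1),\dots,G(i,n))$ for $i\ge 0$ (so $\mathbf{G}(0)=0$); $(\mathbf{G}(i))_{i\ge0}$ is a Markov chain, and the left-hand side of the claim is its transition function. Functions: $H(x)=1$ for $x\ge0$ and $H(x)=0$ for $x<0$. For $x\in\mathbb{Z}$, $w_m(x)=(1-q)^m\binom{x+m-1}{x}q^xH(x)$, which for $m\ge1$ is the $m$-fold convolution of $w(x)=(1-q)q^xH(x)$ with itself; for $m=0$ it reads $w_0(x)=1$ if $x=0$ and $w_0(x)=0$ otherwise. Difference operators: for $f:\mathbb{Z}\to\mathbb{C}$,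 $\Delta f(x)=f(x+1)-f(x)$, $\Delta^0f=f$, and $(\Delta^{-1}f)(x)=\sum_{y=-\infty}^{x-1}f(y)$ whenever the sum converges; $\Delta^k$ and $\Delta^{-k}$ for $k>0$ denote the $k$-fold iterates of $\Delta$ and $\Delta^{-1}$ respectively. *)

theory Defs
  imports
    "HOL-Probability.Probability"
    "Jordan_Normal_Form.Determinant"
begin

(* HOL-Analysis and Jordan_Normal_Form compete for these names; vectors, matrices and det
   are those of Jordan_Normal_Form, because the size n is a natural number. *)
unbundle no vec_syntax
hide_const (open) Determinants.det Finite_Cartesian_Product.vec Finite_Cartesian_Product.mat
hide_type (open) Finite_Cartesian_Product.vec

subsection \<open>Last-passage times\<close>

definition up_right_step :: "nat \<times> nat \<Rightarrow> nat \<times> nat \<Rightarrow> bool" where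
  "up_right_step a b \<longleftrightarrow> b = (fst a + 1, snd a) \<or> b = (fst a, snd a + 1)"

definition up_right_paths :: "nat \<Rightarrow> nat \<Rightarrow> (nat \<times> nat) list set" where
  "up_right_paths m n =
     {p. p \<noteq> [] \<and> hd p = (1, 1) \<and> last p = (m, n) \<and> successively up_right_step p}"

definition last_passage :: "(nat \<Rightarrow> nat \<Rightarrow> nat) \<Rightarrow> nat \<Rightarrow> nat \<Rightarrow> nat" where
  "last_passage u m n =
     (if m = 0 \<or> n = 0 then 0
      else Max ((\<lambda>p. \<Sum>(i, j)\<leftarrow>p. u i j) ` up_right_paths m n))"

(* Vectors are indexed from 0, so component j of the vector is G(i, j + 1). *)
definition G_vec :: "nat \<Rightarrow> (nat \<Rightarrow> nat \<Rightarrow> nat) \<Rightarrow> nat \<Rightarrow> int vec" where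
  "G_vec n u i = vec n (\<lambda>j. int (last_passage u i (j + 1)))"

definition W :: "nat \<Rightarrow> int vec set" where
  "W n = {x \<in> carrier_vec n. \<forall>i j. i \<le> j \<longrightarrow> j < n \<longrightarrow> x $ i \<le> x $ j}"

subsection \<open>The Markov chain started from an arbitrary state\<close>

(* One step of the recursion G(i, j) = max (G(i - 1, j)) (G(i, j - 1)) + w(i, j), as a map from
   the column (G(i - 1, 1), ..., G(i - 1, n)) = x to the column (G(i, 1), ..., G(i, n)), where
   v j = w(i, j) for j = 1, 2, ....  In the first component the boundary value G(i, 0) = 0 is
   dropped from the maximum: this changes nothing when x $ 0 \<ge> 0, in particular along
   the chain started at 0, and it extends the dynamics to states with negative entries
   translation-invariantly. *)
primrec next_col :: "int vec \<Rightarrow> (nat \<Rightarrow> nat) \<Rightarrow> nat \<Rightarrow> int" where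
  "next_col x v 0 = x $ 0 + int (v 1)"
| "next_col x v (Suc j) = max (x $ Suc j) (next_col x v j) + int (v (Suc j + 1))"

(* The state after k steps of the chain that is in state x at time l. *)
primrec G_from :: "nat \<Rightarrow> (nat \<Rightarrow> nat \<Rightarrow> nat) \<Rightarrow> nat \<Rightarrow> int vec \<Rightarrow> nat \<Rightarrow> int vec" where
  "G_from n u l x 0 = x"
| "G_from n u l x (Suc k) = vec n (next_col (G_from n u l x k) (u (l + k + 1)))"

subsection \<open>The functions and difference operators in the determinant\<close>

definition H :: "int \<Rightarrow> real" where
  "H x = (if x \<ge> 0 then 1 else 0)"

(* gchoose is used because for m = 0 and x = 0 the upper entry of the binomial is -1. *)
definition w_conv :: "real \<Rightarrow> nat \<Rightarrow> int \<Rightarrow> real" where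
  "w_conv q m x =
     (1 - q) ^ m * (of_int (x + int m - 1) gchoose nat x) * q powi x * H x"

definition diff_fwd :: "(int \<Rightarrow> 'a) \<Rightarrow> int \<Rightarrow> 'a :: real_normed_vector" where
  "diff_fwd f x = f (x + 1) - f x"

(* The sum of f y over all y \<le> x - 1, as the series f (x - 1) + f (x - 2) + .... *)
definition diff_inv :: "(int \<Rightarrow> 'a) \<Rightarrow> int \<Rightarrow> 'a :: real_normed_vector" where
  "diff_inv f x = (\<Sum>k. f (x - 1 - int k))"

definition diff_pow :: "int \<Rightarrow> (int \<Rightarrow> 'a) \<Rightarrow> int \<Rightarrow> 'a :: real_normed_vector" where
  "diff_pow k = (if k \<ge> 0 then diff_fwd ^^ nat k else diff_inv ^^ nat (- k))"

end

theory Submission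
  imports Defs
begin

text \<open>
  Fix the final state \<open>y\<close> and let \<open>k\<close> time steps remain. As functions of the
  current state \<open>x\<close>, the transition probability and the determinant satisfy the same
  backward recursion in \<open>k\<close>, with the same value \<open>[x = y]\<close> at \<open>k = 0\<close>.

  Entry \<open>(i, j)\<close> of the determinant depends on \<open>x\<close> only through \<open>z = x\<^sub>i\<close>. Write \<open>\<phi> k i z\<close> for
  the row vector with entries \<open>(\<Delta>^(j - i) w\<^sub>k) (y\<^sub>j - z)\<close>. Two linear relations carry the proof:

    \<^item> in time, \<open>(1 - q) \<phi> k i z = \<phi> (k + 1) i z - q \<phi> (k + 1) i (z + 1)\<close>, which is
      Pascal's rule for \<open>w\<^sub>k\<close> (\<open>kernel_entry_time\<close>);
    \<^item> between neighbouring rows, \<open>\<phi> k (i + 1) z = \<phi> k (i + 1) (z + 1) + \<phi> k i (z + 1)\<close>,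
      which is \<open>\<Delta> \<Delta>^r = \<Delta>^(r + 1)\<close> for every integer \<open>r\<close> (\<open>kernel_entry_row\<close>).

  Reveal the weights of one column one at a time. Once the first \<open>i\<close> components have their new
  values, with \<open>z'\<close> the last of them, the remaining components may be replaced by
  \<open>max x\<^sub>a z'\<close>, because the recursion pushes them at least that high anyway. Take the determinant
  whose rows are \<open>\<phi> k\<close> at the new values for the updated components and \<open>\<phi> (k + 1)\<close> at the pushed
  values for the others. Its mean over the next geometric weight is the same determinant before
  the update (\<open>mixed_det_sums\<close>): by the relation in time the mean is a series of differences,
  and this series telescopes, because once row \<open>i\<close> is \<open>\<phi> (k + 1) i (z + 1)\<close>, lifting the level to which
  the later rows are pushed from \<open>z\<close> to \<open>z + 1\<close> only adds to some rows the row above them. The weak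
  ordering of \<open>x\<close> makes these the rows directly after row \<open>i\<close>. The determinant is thus a
  martingale along the revealed weights; running through a whole column lowers \<open>k\<close> by one (\<open>prob_G_from\<close>).

  The conditional probability reduces to the chain started at \<open>x\<close>, since the state at time \<open>l\<close> depends on the
  weights of the first \<open>l\<close> columns and the evolution after time \<open>l\<close> on the later ones.
\<close>

section \<open>Iterated differences of functions supported on a half-line\<close>

definition supp_bdd_below :: "(int \<Rightarrow> real) \<Rightarrow> bool" where
  "supp_bdd_below f \<longleftrightarrow> (\<exists>b. \<forall>x<b. f x = 0)"

lemma summable_supp_bdd_below:
  assumes "supp_bdd_below f"
  shows "summable (\<lambda>k. f (x - int k))"
proof -
  obtain b where b: "\<And>x. x < b \<Longrightarrow> f x = 0"
    using assms by (auto simp: supp_bdd_below_def)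
  show ?thesis
    by (rule summable_finite[of "{..nat (x - b)}"]) (auto intro!: b)
qed

lemma diff_inv_eq_0:
  assumes "\<forall>x<b. f x = 0" "x \<le> b"
  shows "diff_inv f x = (0 :: real)"
  using assms by (simp add: diff_inv_def)

lemma supp_bdd_below_diff_fwd: "supp_bdd_below f \<Longrightarrow> supp_bdd_below (diff_fwd f)"
proof -
  assume "supp_bdd_below f"
  then obtain b where "\<And>x. x < b \<Longrightarrow> f x = 0"
    by (auto simp: supp_bdd_below_def)
  then have "\<forall>x<b - 1. diff_fwd f x = 0"
    by (simp add: diff_fwd_def)
  then show ?thesis by (auto simp: supp_bdd_below_def)
qed

lemma supp_bdd_below_diff_inv: "supp_bdd_below f \<Longrightarrow> supp_bdd_below (diff_inv f)"
  unfolding supp_bdd_below_def by (meson diff_inv_eq_0 less_imp_le)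

text \<open>
  The series defining the inverse difference is finite at every point, and moving the point by one
  adds one term. This is what makes the integer powers of the difference fit together across zero.
\<close>
lemma diff_fwd_of_diff_inv:
  assumes "supp_bdd_below f"
  shows "diff_fwd (diff_inv f) = f"
proof
  fix x
  have "(\<Sum>k. f (x - int (Suc k))) = (\<Sum>k. f (x - int k)) - f (x - int 0)"
    by (rule suminf_split_head) (rule summable_supp_bdd_below[OF assms])
  moreover have "(\<lambda>k. f (x - int (Suc k))) = (\<lambda>k. f (x - 1 - int k))"
    by (simp add: algebra_simps)
  ultimately show "diff_fwd (diff_inv f) x = f x"
    by (simp add: diff_fwd_def diff_inv_def)
qed

lemma supp_bdd_below_funpow:
  assumes "supp_bdd_below f"
  shows "supp_bdd_below ((diff_fwd ^^ k) f)" and "supp_bdd_below ((diff_inv ^^ k) f)"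
  using assms by (induction k) (auto intro: supp_bdd_below_diff_fwd supp_bdd_below_diff_inv)

lemma diff_pow_add_1:
  assumes "supp_bdd_below f"
  shows "diff_pow (k + 1) f = diff_fwd (diff_pow k f)"
proof (cases "k \<ge> 0")
  case True
  then show ?thesis
    by (simp add: diff_pow_def nat_add_distrib)
next
  case False
  define r where "r = nat (- k - 1)"
  have r: "nat (- k) = Suc r" "nat (- (k + 1)) = r"
    using False by (auto simp: r_def)
  have "diff_fwd (diff_pow k f) = (diff_inv ^^ r) f"
    using False r diff_fwd_of_diff_inv[OF supp_bdd_below_funpow(2)[OF assms]]
    by (simp add: diff_pow_def)
  also have "\<dots> = diff_pow (k + 1) f"
  proof (cases "k = -1")
    case True
    then show ?thesis by (simp add: diff_pow_def r_def)
  next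
    case k: False
    then show ?thesis using False r(2) by (simp add: diff_pow_def)
  qed
  finally show ?thesis ..
qed

lemma diff_fwd_funpow_eq_0:
  assumes "\<forall>x<b. f x = 0" "x < b - int k"
  shows "(diff_fwd ^^ k) f x = (0 :: real)"
  using assms(2) by (induction k arbitrary: x) (auto simp: diff_fwd_def assms(1))

lemma diff_inv_funpow_eq_0:
  assumes "\<forall>x<b. f x = 0" "x < b + int k"
  shows "(diff_inv ^^ k) f x = (0 :: real)"
  using assms(2)
proof (induction k arbitrary: x)
  case 0
  then show ?case using assms by simp
next
  case (Suc k)
  then show ?case by (auto intro!: diff_inv_eq_0[of "b + int k"])
qed

lemma diff_pow_eq_0:
  assumes "\<forall>x<b. f x = 0" "x < b - k"
  shows "diff_pow k f x = (0 :: real)"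
proof (cases "k \<ge> 0")
  case True
  then show ?thesis using diff_fwd_funpow_eq_0[OF assms(1)] assms(2)
    by (simp add: diff_pow_def)
next
  case False
  then show ?thesis using diff_inv_funpow_eq_0[OF assms(1)] assms(2)
    by (simp add: diff_pow_def)
qed

text \<open>
  Both difference operators are linear and commute with translations, so a first-order recurrence
  between two functions survives every integer power of the difference. Applied to \<open>w_conv_Suc\<close>,
  this turns Pascal's rule into a relation between rows at consecutive times.
\<close>
lemma diff_pow_recurrence:
  assumes f: "supp_bdd_below f" and h: "supp_bdd_below h"
    and rec: "\<And>x. c * h x = f x - d * f (x - 1)"
  shows "c * diff_pow k h x = diff_pow k f x - d * diff_pow k f (x - 1)"
proof -
  have "\<forall>x. c * (diff_fwd ^^ r) h x = (diff_fwd ^^ r) f x - d * (diff_fwd ^^ r) f (x - 1)" for r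
  proof (induction r)
    case 0
    then show ?case by (simp add: rec)
  next
    case (Suc r)
    define h' f' where "h' = (diff_fwd ^^ r) h" and "f' = (diff_fwd ^^ r) f"
    have IH: "c * h' x = f' x - d * f' (x - 1)" for x
      using Suc by (simp add: h'_def f'_def)
    have "c * diff_fwd h' x = diff_fwd f' x - d * diff_fwd f' (x - 1)" for x
      using IH[of x] IH[of "x + 1"] by (simp add: diff_fwd_def algebra_simps)
    then show ?case by (simp add: h'_def f'_def)
  qed
  moreover have "\<forall>x. c * (diff_inv ^^ r) h x =
      (diff_inv ^^ r) f x - d * (diff_inv ^^ r) f (x - 1)" for r
  proof (induction r)
    case 0
    then show ?case by (simp add: rec)
  next
    case (Suc r)
    define h' f' where "h' = (diff_inv ^^ r) h" and "f' = (diff_inv ^^ r) f"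
    have s: "summable (\<lambda>k. h' (x - int k))" "summable (\<lambda>k. f' (x - int k))" for x
      unfolding h'_def f'_def
      by (intro summable_supp_bdd_below supp_bdd_below_funpow f h)+
    have "c * diff_inv h' x = diff_inv f' x - d * diff_inv f' (x - 1)" for x
    proof -
      have "c * diff_inv h' x = (\<Sum>k. c * h' (x - 1 - int k))"
        unfolding diff_inv_def by (rule suminf_mult[OF s(1), symmetric])
      also have "\<dots> = (\<Sum>k. f' (x - 1 - int k) - d * f' (x - 1 - 1 - int k))"
      proof -
      have "c * h' (x - 1 - int k) = f' (x - 1 - int k) - d * f' (x - 1 - 1 - int k)" for k
        using Suc[rule_format, of "x - 1 - int k"]
        by (simp add: h'_def f'_def algebra_simps)
      then show ?thesis by simp
    qed
      also have "\<dots> = diff_inv f' x - d * diff_inv f' (x - 1)"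
        unfolding diff_inv_def
        by (subst suminf_diff[symmetric]) (auto intro!: s summable_mult simp: suminf_mult s)
      finally show ?thesis .
    qed
    then show ?case by (simp add: h'_def f'_def)
  qed
  ultimately show ?thesis by (simp add: diff_pow_def)
qed

lemma w_conv_neg: "x < 0 \<Longrightarrow> w_conv q m x = 0"
  by (simp add: w_conv_def H_def)

lemma supp_bdd_below_w_conv: "supp_bdd_below (w_conv q m)"
  unfolding supp_bdd_below_def using w_conv_neg by blast

lemma w_conv_0: "w_conv q 0 x = (if x = 0 then 1 else 0)"
proof -
  consider "x < 0" | "x = 0" | n where "x = int (Suc n)"
    by (metis nonneg_int_cases not_less not0_implies_Suc of_nat_0)
  then show ?thesis
  proof cases
    case 3
    have "(of_int (x + int 0 - 1) :: real) = of_nat n"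
      using 3 by simp
    moreover have "(of_nat n :: real) gchoose (Suc n) = 0"
      by (simp flip: binomial_gbinomial)
    ultimately have "(of_int (x + int 0 - 1) :: real) gchoose nat x = 0"
      unfolding 3 nat_int by simp
    then show ?thesis using 3 by (simp add: w_conv_def)
  qed (simp_all add: w_conv_def H_def)
qed

text \<open>
  This inverts the convolution \<open>w_conv q (m + 1) = w_conv q m * w\<close> with the geometric law \<open>w\<close>: the generating
  function \<open>(1 - q) / (1 - q s)\<close> of \<open>w\<close> has the reciprocal \<open>(1 - q s) / (1 - q)\<close>. In coefficients it is Pascal's
  rule.
\<close>
lemma w_conv_Suc:
  assumes "q \<noteq> 0"
  shows "(1 - q) * w_conv q m x = w_conv q (Suc m) x - q * w_conv q (Suc m) (x - 1)"
proof -
  consider "x < 0" | "x = 0" | n where "x = int (Suc n)"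
    by (metis nonneg_int_cases not_less not0_implies_Suc of_nat_0)
  then show ?thesis
  proof cases
    case 3
    define a where "a = (of_int (int n + int m) :: real)"
    have a: "(of_int (x + int m - 1) :: real) = a" "(of_int (x + int (Suc m) - 1) :: real) = a + 1"
      "(of_int (x - 1 + int (Suc m) - 1) :: real) = a"
      using 3 by (simp_all add: a_def)
    have n: "nat x = Suc n" "nat (x - 1) = n"
      using 3 by simp_all
    have "q powi x = q ^ Suc n" "q powi (x - 1) = q ^ n"
      using 3 power_int_of_nat[of q "Suc n"] power_int_of_nat[of q n] by simp_all
    then show ?thesis
      unfolding w_conv_def a n gbinomial_Suc_Suc using 3 by (simp add: H_def algebra_simps)
  qed (simp_all add: w_conv_def H_def)
qed

section \<open>Row relations between determinants\<close>

text \<open>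
  The three matrices share all cofactors along row \<open>i\<close>. The factor \<open>c\<close> stands for the
  \<open>1 - q\<close> on the left-hand side of the time relation.
\<close>
lemma det_linear_in_row:
  fixes a b c :: real
  assumes i: "i < n"
    and eq: "\<And>k j. k < n \<Longrightarrow> j < n \<Longrightarrow> k \<noteq> i \<Longrightarrow> g k j = f k j \<and> h k j = f k j"
    and lin: "\<And>j. j < n \<Longrightarrow> c * f i j = a * g i j + b * h i j"
  shows "c * det (mat n n (\<lambda>(k, j). f k j)) =
         a * det (mat n n (\<lambda>(k, j). g k j)) + b * det (mat n n (\<lambda>(k, j). h k j))"
proof -
  define F G K where "F = mat n n (\<lambda>(k, j). f k j)" and "G = mat n n (\<lambda>(k, j). g k j)"
    and "K = mat n n (\<lambda>(k, j). h k j)"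
  have "mat_delete G i j = mat_delete F i j \<and> mat_delete K i j = mat_delete F i j"
    if "j < n" for j
    using i that by (auto simp: mat_delete_def F_def G_def K_def eq intro!: eq_matI)
  then have cof: "cofactor G i j = cofactor F i j" "cofactor K i j = cofactor F i j" if "j < n" for j
    using that by (simp_all add: cofactor_def)
  have "det F = (\<Sum>j<n. f i j * cofactor F i j)"
    using i by (subst laplace_expansion_row[of F n i]) (auto simp: F_def)
  moreover have "det G = (\<Sum>j<n. g i j * cofactor F i j)"
    using i cof by (subst laplace_expansion_row[of G n i]) (auto simp: G_def)
  moreover have "det K = (\<Sum>j<n. h i j * cofactor F i j)"
    using i cof by (subst laplace_expansion_row[of K n i]) (auto simp: K_def)
  moreover have "(\<Sum>j<n. (c * f i j) * cofactor F i j) =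
      (\<Sum>j<n. (a * g i j + b * h i j) * cofactor F i j)"
    by (intro sum.cong) (simp_all add: lin)
  ultimately have "c * det F = a * det G + b * det K"
    by (simp add: sum_distrib_left sum.distrib algebra_simps)
  then show ?thesis by (simp add: F_def G_def K_def)
qed

text \<open>
  All the additions are simultaneous, each using the unmodified preceding row: the matrix is
  multiplied from the left by a unit lower bidiagonal one.
\<close>
lemma det_add_preceding_rows:
  fixes f g :: "nat \<Rightarrow> nat \<Rightarrow> real"
  assumes "\<And>k j. k < n \<Longrightarrow> j < n \<Longrightarrow> k \<notin> S \<Longrightarrow> g k j = f k j"
    and "\<And>k j. k < n \<Longrightarrow> j < n \<Longrightarrow> k \<in> S \<Longrightarrow> g k j = f k j + f (k - 1) j"
    and "0 \<notin> S"
  shows "det (mat n n (\<lambda>(k, j). g k j)) = det (mat n n (\<lambda>(k, j). f k j))"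
proof -
  define F G L where "F = mat n n (\<lambda>(k, j). f k j)" and "G = mat n n (\<lambda>(k, j). g k j)"
    and "L = mat n n (\<lambda>(k, j). (if j = k then 1 else 0) + (if k \<in> S \<and> j = k - 1 then 1 else 0 :: real))"
  have "G = L * F"
  proof (rule eq_matI)
    fix k j assume "k < dim_row (L * F)" "j < dim_col (L * F)"
    then have kj: "k < n" "j < n" by (simp_all add: L_def F_def)
    have "(L * F) $$ (k, j) = (\<Sum>r = 0..<n. ((if r = k then 1 else 0) +
        (if k \<in> S \<and> r = k - 1 then 1 else 0)) * f r j)"
      using kj by (simp add: L_def F_def scalar_prod_def)
    also have "\<dots> = (\<Sum>r = 0..<n. (if r = k then f r j else 0)) +
        (\<Sum>r = 0..<n. (if r = k - 1 then (if k \<in> S then f r j else 0) else 0))"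
      by (subst sum.distrib[symmetric]) (intro sum.cong, auto)
    also have "\<dots> = g k j"
      using kj assms by (cases "k \<in> S") auto
    finally show "G $$ (k, j) = (L * F) $$ (k, j)"
      using kj by (simp add: G_def)
  qed (simp_all add: G_def L_def F_def)
  moreover have "det L = 1"
  proof -
    have "det L = prod_list (diag_mat L)"
      by (rule det_lower_triangular[of n]) (auto simp: L_def)
    moreover have "L $$ (k, k) = 1" if "k < n" for k
      using that assms(3) by (cases k) (auto simp: L_def)
    ultimately show ?thesis
      by (simp add: prod_list_diag_prod L_def)
  qed
  moreover have "det (L * F) = det L * det F"
    by (rule det_mult[of _ n]) (auto simp: L_def F_def)
  ultimately show ?thesis by (simp add: G_def F_def)
qed

text \<open>
  By the pigeonhole principle no permutation maps \<open>{0, \<dots>, p}\<close> into \<open>{0, \<dots>, p - 1}\<close>, so every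
  summand of the Leibniz formula has a factor in the zero block.
\<close>
lemma det_zero_block:
  fixes A :: "real mat"
  assumes A: "A \<in> carrier_mat n n" and p: "p < n"
    and zero: "\<And>i j. i \<le> p \<Longrightarrow> p \<le> j \<Longrightarrow> j < n \<Longrightarrow> A $$ (i, j) = 0"
  shows "det A = 0"
proof -
  have "(\<Prod>i = 0..<n. A $$ (i, \<pi> i)) = 0" if "\<pi> permutes {0..<n}" for \<pi>
  proof -
    have "\<not> \<pi> ` {..p} \<subseteq> {..<p}"
    proof
      assume "\<pi> ` {..p} \<subseteq> {..<p}"
      then have "card (\<pi> ` {..p}) \<le> p"
        using card_mono[of "{..<p}"] by simp
      moreover have "card (\<pi> ` {..p}) = Suc p"
        using permutes_inj[OF that] by (simp add: card_image inj_on_subset)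
      ultimately show False by simp
    qed
    then obtain i where "i \<le> p" "p \<le> \<pi> i" by fastforce
    moreover have "\<pi> i < n"
      using permutes_in_image[OF that, of i] \<open>i \<le> p\<close> p by simp
    ultimately show ?thesis
      using zero p by (intro prod_zero) (auto intro!: bexI[of _ i])
  qed
  then show ?thesis
    unfolding det_def'[OF A] by (intro sum.neutral) auto
qed

section \<open>Revealing one weight inside the determinant\<close>

text \<open>
  The position \<open>z\<close> stands for \<open>x\<^sub>i\<close>: row \<open>i\<close> of the determinant is this function of \<open>z\<close>, with \<open>k\<close> the
  number of remaining time steps.
\<close>
definition kernel_entry :: "real \<Rightarrow> nat \<Rightarrow> int vec \<Rightarrow> nat \<Rightarrow> nat \<Rightarrow> int \<Rightarrow> real" where
  "kernel_entry q k y i j z = diff_pow (int j - int i) (w_conv q k) (y $ j - z)"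

lemma kernel_entry_row:
  "kernel_entry q k y (Suc i) j z = kernel_entry q k y (Suc i) j (z + 1) + kernel_entry q k y i j (z + 1)"
proof -
  have "diff_pow (int j - int i) (w_conv q k) = diff_fwd (diff_pow (int j - int (Suc i)) (w_conv q k))"
    using diff_pow_add_1[OF supp_bdd_below_w_conv, of "int j - int (Suc i)" q k] by simp
  then show ?thesis
    by (simp add: kernel_entry_def diff_fwd_def algebra_simps)
qed

lemma kernel_entry_time:
  assumes "q \<noteq> 0"
  shows "(1 - q) * kernel_entry q k y i j z =
    kernel_entry q (Suc k) y i j z - q * kernel_entry q (Suc k) y i j (z + 1)"
proof -
  have "(1 - q) * diff_pow (int j - int i) (w_conv q k) (y $ j - z) =
      diff_pow (int j - int i) (w_conv q (Suc k)) (y $ j - z) -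
      q * diff_pow (int j - int i) (w_conv q (Suc k)) (y $ j - z - 1)"
    by (rule diff_pow_recurrence[OF supp_bdd_below_w_conv supp_bdd_below_w_conv w_conv_Suc[OF assms]])
  then show ?thesis by (simp add: kernel_entry_def algebra_simps)
qed

lemma kernel_entry_eq_0:
  assumes "z > y $ j + int j"
  shows "kernel_entry q k y i j z = 0"
  unfolding kernel_entry_def
  by (rule diff_pow_eq_0[of 0]) (use assms in \<open>auto simp: w_conv_neg\<close>)

text \<open>
  The determinant in the middle of a column update, when \<open>k\<close> full time steps follow the current one:
  the components below \<open>i\<close> have already reached their new values \<open>s\<close>, while the others, at the
  positions \<open>t\<close>, still have the current step before them.
\<close>
definition mixed_det ::
    "real \<Rightarrow> nat \<Rightarrow> nat \<Rightarrow> int vec \<Rightarrow> nat \<Rightarrow> (nat \<Rightarrow> int) \<Rightarrow> (nat \<Rightarrow> int) \<Rightarrow> real" where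
  "mixed_det q k n y i s t = det (mat n n (\<lambda>(a, j).
     if a < i then kernel_entry q k y a j (s a) else kernel_entry q (Suc k) y a j (t a)))"

lemma mixed_det_cong:
  assumes "\<And>a. a < i \<Longrightarrow> s a = s' a" "\<And>a. i \<le> a \<Longrightarrow> a < n \<Longrightarrow> t a = t' a"
  shows "mixed_det q k n y i s t = mixed_det q k n y i s' t'"
  unfolding mixed_det_def
  by (rule arg_cong[where f = det]) (auto intro!: eq_matI simp: assms)

lemma mixed_det_row_eq_0:
  assumes "i < n" "\<forall>j<n. t i > y $ j + int j"
  shows "mixed_det q k n y i s t = 0"
proof -
  define f where "f = (\<lambda>a j. if a < i then kernel_entry q k y a j (s a)
    else kernel_entry q (Suc k) y a j (t a))"
  have "1 * det (mat n n (\<lambda>(a, j). f a j)) = 0 * det (mat n n (\<lambda>(a, j). f a j)) +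
      0 * det (mat n n (\<lambda>(a, j). f a j))"
    by (rule det_linear_in_row[OF assms(1)]) (use assms in \<open>auto simp: f_def kernel_entry_eq_0\<close>)
  then show ?thesis by (simp add: mixed_det_def f_def)
qed

text \<open>
  The time relation splits row \<open>i\<close> into the rows of time \<open>k + 1\<close> at \<open>z\<close> and at \<open>z + 1\<close>. In the second
  term the later rows are still pushed to level \<open>z\<close> only. Raising that level to \<open>z + 1\<close> changes exactly
  the rows with \<open>x\<^sub>a \<le> z\<close>; by the ordering of \<open>x\<close> these directly follow row \<open>i\<close>, all sit at the same
  position, and the row relation makes the change an addition of the preceding row. Afterwards the
  second term is the first one with \<open>z + 1\<close> in place of \<open>z\<close>, ready for telescoping.
\<close>
lemma mixed_det_geometric_difference:
  assumes q: "q \<noteq> 0" and i: "i < n"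
    and x: "\<And>a b. i < a \<Longrightarrow> a \<le> b \<Longrightarrow> b < n \<Longrightarrow> x a \<le> x b"
  shows "(1 - q) * mixed_det q k n y (Suc i) (s(i := z)) (\<lambda>a. max (x a) z) =
     mixed_det q k n y i s ((\<lambda>a. max (x a) z)(i := z)) -
     q * mixed_det q k n y i s ((\<lambda>a. max (x a) (z + 1))(i := z + 1))"
proof -
  define e where "e = (\<lambda>k a j z. kernel_entry q k y a j z)"
  define f where "f = (\<lambda>r z a j. if a < i then e k a j (s a) else
     if a = i then r j else e (Suc k) a j (max (x a) z))"
  define D where "D = (\<lambda>r z. det (mat n n (\<lambda>(a, j). f r z a j)))"
  have "(1 - q) * D (\<lambda>j. e k i j z) z = 1 * D (\<lambda>j. e (Suc k) i j z) z +
      (- q) * D (\<lambda>j. e (Suc k) i j (z + 1)) z"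
    unfolding D_def
    by (rule det_linear_in_row[OF i])
      (auto simp: f_def e_def kernel_entry_time[OF q])
  moreover have "D (\<lambda>j. e (Suc k) i j (z + 1)) z = D (\<lambda>j. e (Suc k) i j (z + 1)) (z + 1)"
    unfolding D_def
  proof (rule det_add_preceding_rows[where S = "{a. i < a \<and> a < n \<and> x a \<le> z}"])
    \<comment> \<open>The row above is row \<open>i\<close> itself or, by the ordering, another row pushed to \<open>z + 1\<close>.\<close>
    fix a j assume aj: "a < n" "j < n" "a \<in> {a. i < a \<and> a < n \<and> x a \<le> z}"
    have "x (a - 1) \<le> z" if "a - 1 \<noteq> i"
      using x[of "a - 1" a] aj that by fastforce
    with aj show "f (\<lambda>j. e (Suc k) i j (z + 1)) z a j =
        f (\<lambda>j. e (Suc k) i j (z + 1)) (z + 1) a j + f (\<lambda>j. e (Suc k) i j (z + 1)) (z + 1) (a - 1) j"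
      using kernel_entry_row[of q "Suc k" y "a - 1" j z]
      by (cases "a - 1 = i") (auto simp: f_def e_def max_def)
  next
    fix a j assume "a < n" "j < n" "a \<notin> {a. i < a \<and> a < n \<and> x a \<le> z}"
    then have "max (x a) z = max (x a) (z + 1) \<or> a \<le> i" by auto
    then show "f (\<lambda>j. e (Suc k) i j (z + 1)) z a j = f (\<lambda>j. e (Suc k) i j (z + 1)) (z + 1) a j"
      by (auto simp: f_def)
  qed simp
  moreover have "D (\<lambda>j. e k i j z) z = mixed_det q k n y (Suc i) (s(i := z)) (\<lambda>a. max (x a) z)"
    "D (\<lambda>j. e (Suc k) i j z') z' = mixed_det q k n y i s ((\<lambda>a. max (x a) z')(i := z'))" for z'
    unfolding D_def mixed_det_def
    by (rule arg_cong[where f = det]; auto intro!: eq_matI simp: f_def e_def less_Suc_eq)+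
  ultimately show ?thesis by simp
qed

text \<open>
  The left-hand side is the mean, over a geometric weight \<open>v\<close>, of the determinant after component \<open>i\<close>
  has moved from \<open>z\<close> to \<open>z + v\<close> and pushed the later components. The boundary term of the
  telescoping series vanishes because row \<open>i\<close> is zero beyond the support of its entries.
\<close>
lemma mixed_det_sums:
  assumes q: "0 < q" "q < 1" and i: "i < n"
    and x: "\<And>a b. i < a \<Longrightarrow> a \<le> b \<Longrightarrow> b < n \<Longrightarrow> x a \<le> x b"
  shows "(\<lambda>v. (1 - q) * q ^ v *
           mixed_det q k n y (Suc i) (s(i := z + int v)) (\<lambda>a. max (x a) (z + int v)))
         sums mixed_det q k n y i s ((\<lambda>a. max (x a) z)(i := z))"
proof -
  define A where "A = (\<lambda>v. mixed_det q k n y i s ((\<lambda>a. max (x a) (z + int v))(i := z + int v)))"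
  have "(\<lambda>v. q ^ v * A v) \<longlonglongrightarrow> 0"
  proof (rule tendsto_eventually)
    define B where "B = Max ((\<lambda>j. y $ j + int j) ` {..<n})"
    have "y $ j + int j \<le> B" if "j < n" for j
      unfolding B_def using that by (intro Max_ge) auto
    then have "A v = 0" if "v \<ge> nat (B - z + 1)" for v
      unfolding A_def using that by (intro mixed_det_row_eq_0[OF i]) force
    then show "eventually (\<lambda>v. q ^ v * A v = 0) sequentially"
      by (auto intro!: eventually_sequentiallyI)
  qed
  then have "(\<lambda>v. q ^ v * A v - q ^ Suc v * A (Suc v)) sums (q ^ 0 * A 0 - 0)"
    by (rule telescope_sums')
  moreover have "(1 - q) * q ^ v *
      mixed_det q k n y (Suc i) (s(i := z + int v)) (\<lambda>a. max (x a) (z + int v)) =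
      q ^ v * A v - q ^ Suc v * A (Suc v)" for v
  proof -
    have "(1 - q) * mixed_det q k n y (Suc i) (s(i := z + int v)) (\<lambda>a. max (x a) (z + int v)) =
        A v - q * A (Suc v)"
      using mixed_det_geometric_difference[of q i n x k y s "z + int v"] q i x
      by (simp add: A_def algebra_simps)
    then have "q ^ v * ((1 - q) * mixed_det q k n y (Suc i) (s(i := z + int v))
        (\<lambda>a. max (x a) (z + int v))) = q ^ v * (A v - q * A (Suc v))"
      by simp
    then show ?thesis by (simp add: algebra_simps)
  qed
  ultimately show ?thesis by (simp add: A_def)
qed

section \<open>The determinant at time zero\<close>

definition transition_det :: "real \<Rightarrow> nat \<Rightarrow> nat \<Rightarrow> int vec \<Rightarrow> int vec \<Rightarrow> real" where
  "transition_det q n k x y = det (mat n n (\<lambda>(i, j). kernel_entry q k y i j (x $ i)))"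

text \<open>
  At time zero the entries are iterated differences of a unit mass at \<open>0\<close>. Nonnegative powers do not
  extend its support to the right, and the negative power \<open>-r\<close> gives a function vanishing to the left
  of \<open>r\<close>.
\<close>
lemma kernel_entry_0_upper:
  assumes "i \<le> j" "x $ i < y $ j"
  shows "kernel_entry q 0 y i j (x $ i) = 0"
proof -
  have "u > 0 \<Longrightarrow> (diff_fwd ^^ r) (w_conv q 0) u = 0" for r u
    by (induction r arbitrary: u) (auto simp: w_conv_0 diff_fwd_def)
  then show ?thesis
    using assms by (simp add: kernel_entry_def diff_pow_def)
qed

lemma kernel_entry_0_lower:
  assumes "j \<le> i" "y $ j \<le> x $ i" "j = i \<Longrightarrow> y $ j < x $ i"
  shows "kernel_entry q 0 y i j (x $ i) = 0"
proof (cases "j = i")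
  case True
  then show ?thesis using assms by (simp add: kernel_entry_def diff_pow_def w_conv_0)
next
  case False
  then show ?thesis
    unfolding kernel_entry_def
    by (intro diff_pow_eq_0[of 0]) (use assms in \<open>auto simp: w_conv_neg\<close>)
qed

text \<open>
  For \<open>x = y\<close> the matrix is unit upper triangular. Otherwise let \<open>p\<close> be the first index at which the
  two states differ. According to the sign of \<open>y\<^sub>p - x\<^sub>p\<close>, either the rows up to \<open>p\<close> vanish in the
  columns from \<open>p\<close> on, or the columns up to \<open>p\<close> vanish in the rows from \<open>p\<close> on.
\<close>
lemma transition_det_0:
  assumes x: "x \<in> W n" and y: "y \<in> W n"
  shows "transition_det q n 0 x y = (if x = y then 1 else 0)"
proof (cases "x = y")
  case True
  define A where "A = mat n n (\<lambda>(i, j). kernel_entry q 0 x i j (x $ i))"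
  have "upper_triangular A"
    using x by (intro upper_triangularI) (auto simp: A_def W_def intro!: kernel_entry_0_lower)
  then have "det A = prod_list (diag_mat A)"
    by (rule det_upper_triangular[of _ n]) (simp add: A_def)
  also have "\<dots> = 1"
    by (simp add: prod_list_diag_prod A_def kernel_entry_def diff_pow_def w_conv_0)
  finally show ?thesis using True by (simp add: transition_det_def A_def)
next
  case False
  define A where "A = mat n n (\<lambda>(i, j). kernel_entry q 0 y i j (x $ i))"
  have A: "A \<in> carrier_mat n n" by (simp add: A_def)
  have "\<exists>p<n. x $ p \<noteq> y $ p"
    using x y False by (auto simp: W_def)
  then obtain p where p: "p < n" "x $ p \<noteq> y $ p" "\<And>j. j < p \<Longrightarrow> x $ j = y $ j"
    using exists_least_iff[of "\<lambda>p. p < n \<and> x $ p \<noteq> y $ p"] by fastforce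
  have mono: "x $ i \<le> x $ j" "y $ i \<le> y $ j" if "i \<le> j" "j < n" for i j
    using x y that by (auto simp: W_def)
  have "det A = 0"
  proof (cases "x $ p < y $ p")
    case True
    show ?thesis
    proof (rule det_zero_block[OF A p(1)])
      fix i j assume "i \<le> p" "p \<le> j" "j < n"
      moreover have "x $ i \<le> x $ p" "y $ p \<le> y $ j"
        using calculation p(1) by (auto intro: mono)
      ultimately show "A $$ (i, j) = 0"
        using True p(1) by (auto simp: A_def intro!: kernel_entry_0_upper)
    qed
  next
    case False
    have "det A\<^sup>T = 0"
    proof (rule det_zero_block[OF _ p(1)])
      fix j i assume ij: "j \<le> p" "p \<le> i" "i < n"
      have "y $ j \<le> y $ p" "x $ p \<le> x $ i"
        using ij p(1) by (auto intro: mono)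
      moreover have "y $ j \<le> x $ i"
        using calculation False by linarith
      moreover have "y $ j < x $ i" if "j = i"
        using that ij calculation False p(2) by force
      ultimately show "A\<^sup>T $$ (j, i) = 0"
        using ij p(1) by (auto simp: A_def intro!: kernel_entry_0_lower)
    qed (simp add: A_def)
    then show ?thesis using det_transpose[OF A] by simp
  qed
  then show ?thesis using \<open>x \<noteq> y\<close> by (simp add: transition_det_def A_def)
qed

section \<open>Last-passage times as a chain of columns\<close>

lemma next_col_cong:
  assumes "\<And>i. i \<le> j \<Longrightarrow> v (Suc i) = v' (Suc i)"
  shows "next_col x v j = next_col x v' j"
  using assms by (induction j) auto

lemma next_col_W:
  "vec n (next_col x v) \<in> W n"
proof -
  have "next_col x v i \<le> next_col x v j" if "i \<le> j" for i j
    using that by (induction rule: dec_induct) auto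
  then show ?thesis by (auto simp: W_def)
qed

text \<open>
  The definition unfolds the last step; backward induction in time needs the first one.
\<close>
lemma G_from_Suc_start:
  "G_from n u l x (Suc k) = G_from n u (Suc l) (vec n (next_col x (u (Suc l)))) k"
  by (induction k) simp_all

lemma G_from_cong:
  assumes "\<And>i j. l < i \<Longrightarrow> i \<le> l + k \<Longrightarrow> 1 \<le> j \<Longrightarrow> j \<le> n \<Longrightarrow> u i j = u' i j"
  shows "G_from n u l x k = G_from n u' l x k"
  using assms
proof (induction k)
  case (Suc k)
  then have "G_from n u l x k = G_from n u' l x k" by simp
  moreover have "next_col z (u (l + k + 1)) j = next_col z (u' (l + k + 1)) j" if "j < n" for z j
    using that Suc.prems by (intro next_col_cong) auto
  ultimately show ?case by (auto intro!: eq_vecI)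
qed simp

lemma up_right_path_mono:
  assumes "successively up_right_step p" "p \<noteq> []"
  shows "fst (hd p) \<le> fst (last p) \<and> snd (hd p) \<le> snd (last p)"
  using assms by (induction p rule: induct_list012) (force simp: up_right_step_def)+

lemma up_right_paths_pos: "p \<in> up_right_paths m n \<Longrightarrow> 1 \<le> m \<and> 1 \<le> n"
  using up_right_path_mono[of p] by (auto simp: up_right_paths_def)

lemma up_right_paths_1_1: "up_right_paths 1 1 = {[(1, 1)]}"
proof -
  have "p = [(1, 1)]" if p: "p \<in> up_right_paths 1 1" for p
  proof (cases p rule: rev_cases)
    case (snoc p' a)
    have "p' = []"
    proof (rule ccontr)
      assume "p' \<noteq> []"
      with p snoc have "p' \<in> up_right_paths (fst (last p')) (snd (last p'))"
        "up_right_step (last p') (1, 1)"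
        by (auto simp: up_right_paths_def successively_append_iff)
      then show False
        using up_right_paths_pos by (fastforce simp: up_right_step_def)
    qed
    then show ?thesis using p snoc by (simp add: up_right_paths_def)
  qed (use p in \<open>simp add: up_right_paths_def\<close>)
  moreover have "[(1, 1)] \<in> up_right_paths 1 1"
    by (simp add: up_right_paths_def)
  ultimately show ?thesis by blast
qed

lemma up_right_paths_snoc:
  assumes "(m, n) \<noteq> (0, 0)"
  shows "up_right_paths (Suc m) (Suc n) =
    (\<lambda>p. p @ [(Suc m, Suc n)]) ` (up_right_paths m (Suc n) \<union> up_right_paths (Suc m) n)"
    (is "_ = ?snoc ` ?A")
proof (intro Set.set_eqI iffI)
  fix p assume p: "p \<in> up_right_paths (Suc m) (Suc n)"
  show "p \<in> ?snoc ` ?A"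
  proof (cases p rule: rev_cases)
    case (snoc p' a)
    have "p' \<noteq> []" using p snoc assms by (auto simp: up_right_paths_def)
    moreover have "a = (Suc m, Suc n)" using p snoc by (simp add: up_right_paths_def)
    ultimately have "p' \<in> up_right_paths (fst (last p')) (snd (last p'))"
      "up_right_step (last p') (Suc m, Suc n)"
      using p snoc by (auto simp: up_right_paths_def successively_append_iff)
    then have "p' \<in> ?A"
      by (auto simp: up_right_step_def)
    then show ?thesis using snoc \<open>a = _\<close> by blast
  qed (use p in \<open>simp add: up_right_paths_def\<close>)
qed (auto simp: up_right_paths_def successively_append_iff up_right_step_def)

lemma finite_up_right_paths: "finite (up_right_paths m n)"
proof (induction "m + n" arbitrary: m n rule: less_induct)
  case less
  show ?case
  proof (cases "m = 0 \<or> n = 0")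
    case True
    then have "up_right_paths m n = {}"
      using up_right_paths_pos[of _ m n] by fastforce
    then show ?thesis by simp
  next
    case False
    then obtain m' n' where mn: "m = Suc m'" "n = Suc n'"
      by (metis not0_implies_Suc)
    show ?thesis
    proof (cases "(m', n') = (0, 0)")
      case True
      then show ?thesis using mn up_right_paths_1_1 by simp
    next
      case False
      then show ?thesis using less[of m' n] less[of m n'] mn up_right_paths_snoc[OF False] by simp
    qed
  qed
qed

lemma up_right_paths_nonempty: "up_right_paths (Suc m) (Suc n) \<noteq> {}"
proof (induction "m + n" arbitrary: m n rule: less_induct)
  case less
  show ?case
  proof (cases "(m, n) = (0, 0)")
    case True
    then show ?thesis using up_right_paths_1_1 by simp
  next
    case False
    then obtain k where "m = Suc k \<or> n = Suc k"
      by (metis not0_implies_Suc)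
    then show ?thesis
      using less[of k n] less[of m k] unfolding up_right_paths_snoc[OF False] by auto
  qed
qed

lemma last_passage_0: "last_passage u 0 n = 0" "last_passage u m 0 = 0"
  by (simp_all add: last_passage_def)

text \<open>
  A path of more than one point enters \<open>(m + 1, n + 1)\<close> from the left or from below. On an axis there are no paths,
  and the value \<open>0\<close> assigned there is neutral for the maximum of natural numbers.
\<close>
lemma last_passage_rec:
  "last_passage u (Suc m) (Suc n) =
     max (last_passage u m (Suc n)) (last_passage u (Suc m) n) + u (Suc m) (Suc n)"
proof (cases "(m, n) = (0, 0)")
  case True
  then show ?thesis
    using up_right_paths_1_1 by (simp add: last_passage_def)
next
  case False
  define S where "S = (\<lambda>p. \<Sum>(i, j)\<leftarrow>p. u i j)"
  \<comment> \<open>The maximum over a possibly empty set of paths, so that boundary points need no separate treatment.\<close>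
  define mx where "mx = (\<lambda>A. if A = {} then 0 else Max (S ` A))"
  define A where "A = up_right_paths m (Suc n) \<union> up_right_paths (Suc m) n"
  have mx: "last_passage u a b = mx (up_right_paths a b)" for a b
  proof (cases "a = 0 \<or> b = 0")
    case True
    then have "up_right_paths a b = {}"
      using up_right_paths_pos[of _ a b] by fastforce
    then show ?thesis using True by (simp add: last_passage_def mx_def)
  next
    case False
    then have "up_right_paths a b \<noteq> {}"
      using up_right_paths_nonempty[of "a - 1" "b - 1"] by simp
    then show ?thesis using False by (simp add: last_passage_def mx_def S_def)
  qed
  have A: "finite A" "A \<noteq> {}"
    using up_right_paths_nonempty[of m n]
    by (auto simp: A_def finite_up_right_paths up_right_paths_snoc[OF False])
  have "last_passage u (Suc m) (Suc n) = Max ((\<lambda>p. S p + u (Suc m) (Suc n)) ` A)"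
    by (simp add: last_passage_def up_right_paths_snoc[OF False] image_image S_def A_def)
  also have "\<dots> = mx A + u (Suc m) (Suc n)"
    using Max_add_commute[OF A, of S] A by (simp add: mx_def)
  also have "mx A = max (mx (up_right_paths m (Suc n))) (mx (up_right_paths (Suc m) n))"
    by (auto simp: A_def mx_def image_Un Max_Un finite_up_right_paths)
  finally show ?thesis by (simp add: mx)
qed

text \<open>
  For the first component the boundary value \<open>0\<close> drops out because last-passage times are
  nonnegative.
\<close>
lemma G_vec_Suc: "G_vec n u (Suc i) = vec n (next_col (G_vec n u i) (u (Suc i)))"
proof (rule eq_vecI)
  fix j assume "j < dim_vec (vec n (next_col (G_vec n u i) (u (Suc i))))"
  then have "j < n" by simp
  then have "int (last_passage u (Suc i) (Suc j)) = next_col (G_vec n u i) (u (Suc i)) j"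
    by (induction j) (simp_all add: last_passage_rec last_passage_0 G_vec_def)
  then show "G_vec n u (Suc i) $ j = vec n (next_col (G_vec n u i) (u (Suc i))) $ j"
    using \<open>j < n\<close> by (simp add: G_vec_def)
qed (simp add: G_vec_def)

lemma G_vec_add: "G_vec n u (l + k) = G_from n u l (G_vec n u l) k"
  by (induction k) (simp_all add: G_vec_Suc)

lemma G_vec_cong:
  assumes "\<And>i j. 1 \<le> i \<Longrightarrow> i \<le> l \<Longrightarrow> 1 \<le> j \<Longrightarrow> j \<le> n \<Longrightarrow> u i j = u' i j"
  shows "G_vec n u l = G_vec n u' l"
proof -
  have "G_vec n u 0 = G_vec n u' 0"
    by (simp add: G_vec_def last_passage_0)
  moreover have "G_from n u 0 z l = G_from n u' 0 z l" for z
    by (rule G_from_cong) (use assms in auto)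
  ultimately show ?thesis
    using G_vec_add[of n u 0 l] G_vec_add[of n u' 0 l] by simp
qed

section \<open>Independence of events on disjoint sets of weights\<close>

context prob_space
begin

text \<open>
  Finitely many discrete variables form a discrete random vector, so every event that depends on them
  alone is measurable, and vectors of disjoint index sets are independent.
\<close>
lemma
  fixes X :: "'i \<Rightarrow> 'a \<Rightarrow> 'b :: countable"
  assumes ind: "indep_vars (\<lambda>_. count_space UNIV) X I"
    and A: "finite A" "A \<subseteq> I" "\<And>f g. (\<And>i. i \<in> A \<Longrightarrow> f i = g i) \<Longrightarrow> P f \<longleftrightarrow> P g"
    and B: "finite B" "B \<subseteq> I" "\<And>f g. (\<And>i. i \<in> B \<Longrightarrow> f i = g i) \<Longrightarrow> Q f \<longleftrightarrow> Q g"
    and disj: "A \<inter> B = {}"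
  shows events_finite_dependence: "{\<omega> \<in> space M. P (\<lambda>i. X i \<omega>)} \<in> events"
    and prob_disjoint_dependence: "prob {\<omega> \<in> space M. P (\<lambda>i. X i \<omega>) \<and> Q (\<lambda>i. X i \<omega>)} =
      prob {\<omega> \<in> space M. P (\<lambda>i. X i \<omega>)} * prob {\<omega> \<in> space M. Q (\<lambda>i. X i \<omega>)}"
proof -
  define XA XB where "XA = (\<lambda>\<omega>. restrict (\<lambda>i. X i \<omega>) A)" and "XB = (\<lambda>\<omega>. restrict (\<lambda>i. X i \<omega>) B)"
  define SA SB where "SA = {f \<in> PiE A (\<lambda>_. UNIV). P f}" and "SB = {f \<in> PiE B (\<lambda>_. UNIV). Q f}"
  have PiM: "PiM C (\<lambda>_. count_space UNIV) = count_space (PiE C (\<lambda>_. UNIV :: 'b set))"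
    if "finite C" for C :: "'i set"
    using that by (intro count_space_PiM_finite) auto
  have ind': "indep_var (count_space (PiE A (\<lambda>_. UNIV))) XA (count_space (PiE B (\<lambda>_. UNIV))) XB"
    using indep_var_restrict[OF ind disj A(2) B(2)] A(1) B(1) by (simp add: PiM XA_def XB_def)
  have P: "P (XA \<omega>) = P (\<lambda>i. X i \<omega>)" and Q: "Q (XB \<omega>) = Q (\<lambda>i. X i \<omega>)" for \<omega>
    by (rule A(3), simp add: XA_def) (rule B(3), simp add: XB_def)
  have eqA: "XA -` SA \<inter> space M = {\<omega> \<in> space M. P (\<lambda>i. X i \<omega>)}"
    using P by (auto simp: SA_def) (auto simp: XA_def)
  have eqB: "XB -` SB \<inter> space M = {\<omega> \<in> space M. Q (\<lambda>i. X i \<omega>)}"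
    using Q by (auto simp: SB_def) (auto simp: XB_def)
  show "{\<omega> \<in> space M. P (\<lambda>i. X i \<omega>)} \<in> events"
    unfolding eqA[symmetric] using indep_var_rv1[OF ind']
    by (rule measurable_sets) (auto simp: SA_def)
  have "(\<lambda>\<omega>. (XA \<omega>, XB \<omega>)) -` (SA \<times> SB) \<inter> space M =
      (XA -` SA \<inter> space M) \<inter> (XB -` SB \<inter> space M)" by auto
  also have "\<dots> = {\<omega> \<in> space M. P (\<lambda>i. X i \<omega>) \<and> Q (\<lambda>i. X i \<omega>)}"
    unfolding eqA eqB by auto
  finally show "prob {\<omega> \<in> space M. P (\<lambda>i. X i \<omega>) \<and> Q (\<lambda>i. X i \<omega>)} =
      prob {\<omega> \<in> space M. P (\<lambda>i. X i \<omega>)} * prob {\<omega> \<in> space M. Q (\<lambda>i. X i \<omega>)}"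
    using indep_varD[OF ind', of SA SB] eqA eqB by (simp add: SA_def SB_def)
qed

text \<open>
  The law of total probability for one coordinate: on \<open>X\<^sub>p = v\<close> the coordinate may be replaced by the
  constant \<open>v\<close>, after which the event depends on the other coordinates only and is independent of
  \<open>X\<^sub>p\<close>.
\<close>
lemma prob_condition_on_coordinate:
  fixes X :: "'i \<Rightarrow> 'a \<Rightarrow> nat"
  assumes ind: "indep_vars (\<lambda>_. count_space UNIV) X I"
    and J: "finite J" "J \<subseteq> I" "\<And>f g. (\<And>i. i \<in> J \<Longrightarrow> f i = g i) \<Longrightarrow> P f \<longleftrightarrow> P g"
    and p: "p \<in> I"
  shows "(\<lambda>v. prob {\<omega> \<in> space M. X p \<omega> = v} * prob {\<omega> \<in> space M. P ((\<lambda>i. X i \<omega>)(p := v))})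
    sums prob {\<omega> \<in> space M. P (\<lambda>i. X i \<omega>)}"
proof -
  define E where "E = (\<lambda>v. {\<omega> \<in> space M. X p \<omega> = v \<and> P (\<lambda>i. X i \<omega>)})"
  have "E v \<in> events" for v
    unfolding E_def
  proof (rule events_finite_dependence[OF ind, where A = "insert p J" and B = "{}"
        and P = "\<lambda>f. f p = v \<and> P f" and Q = "\<lambda>_. True"])
    fix f g :: "'i \<Rightarrow> nat"
    assume "\<And>i. i \<in> insert p J \<Longrightarrow> f i = g i"
    then show "f p = v \<and> P f \<longleftrightarrow> g p = v \<and> P g"
      using J(3)[of f g] by simp
  qed (use J(1,2) p in simp_all)
  then have "(\<lambda>v. prob (E v)) sums prob (\<Union>v. E v)"
    by (intro finite_measure_UNION) (auto simp: disjoint_family_on_def E_def)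
  moreover have "(\<Union>v. E v) = {\<omega> \<in> space M. P (\<lambda>i. X i \<omega>)}"
    by (auto simp: E_def)
  moreover have "prob (E v) =
      prob {\<omega> \<in> space M. X p \<omega> = v} * prob {\<omega> \<in> space M. P ((\<lambda>i. X i \<omega>)(p := v))}" for v
  proof -
    have "E v = {\<omega> \<in> space M. X p \<omega> = v \<and> P ((\<lambda>i. X i \<omega>)(p := v))}"
      unfolding E_def by (auto simp: fun_upd_idem)
    also have "prob \<dots> =
        prob {\<omega> \<in> space M. X p \<omega> = v} * prob {\<omega> \<in> space M. P ((\<lambda>i. X i \<omega>)(p := v))}"
      proof (rule prob_disjoint_dependence[OF ind, where A = "{p}" and B = "J - {p}"
        and P = "\<lambda>f. f p = v" and Q = "\<lambda>f. P (f(p := v))"])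
      fix f g :: "'i \<Rightarrow> nat"
      assume "\<And>i. i \<in> J - {p} \<Longrightarrow> f i = g i"
      then show "P (f(p := v)) \<longleftrightarrow> P (g(p := v))"
        by (intro J(3)) auto
    qed (use J(1,2) p in auto)
    finally show ?thesis .
  qed
  ultimately show ?thesis by simp
qed

end

section \<open>The transition function\<close>

text \<open>
  The outer induction is over the number of remaining time steps. Inside a step, a downward induction
  over \<open>i\<close> treats the first \<open>i\<close> weights of the current column as given numbers \<open>c\<close> and averages over
  the next one, which lowers \<open>i\<close>.
\<close>
lemma (in prob_space) prob_G_from:
  fixes X :: "nat \<times> nat \<Rightarrow> 'a \<Rightarrow> nat"
  assumes q: "0 < q" "q < 1"
    and ind: "indep_vars (\<lambda>_. count_space UNIV) X ({1..} \<times> {1..})"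
    and geo: "\<And>p v. p \<in> {1..} \<times> {1..} \<Longrightarrow>
      prob {\<omega> \<in> space M. X p \<omega> = v} = (1 - q) * q ^ v"
    and x: "x \<in> W n" and y: "y \<in> W n"
  shows "prob {\<omega> \<in> space M. G_from n (\<lambda>i j. X (i, j) \<omega>) l x k = y} = transition_det q n k x y"
  using x
proof (induction k arbitrary: l x)
  case 0
  then show ?case using y by (simp add: transition_det_0 prob_space)
next
  case (Suc k)
  \<comment> \<open>\<open>u i c f\<close> is the environment \<open>f\<close> with the first \<open>i\<close> weights of column \<open>l + 1\<close> replaced by \<open>c\<close>,
    \<open>E\<close> the event of ending at \<open>y\<close> in it, and \<open>t\<close> the components not yet updated, pushed by the last
    updated one.\<close>
  define u where "u = (\<lambda>i (c :: nat \<Rightarrow> nat) f p. if fst p = Suc l \<and> snd p \<le> i then c (snd p) else f p :: nat)"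
  define E where "E = (\<lambda>i c f. G_from n (\<lambda>a b. u i c f (a, b)) l x (Suc k) = y)"
  define t where "t = (\<lambda>i c a. if i = 0 then x $ a else max (x $ a) (next_col x c (i - 1)))"
  have E_cong: "E i c f \<longleftrightarrow> E i c' g"
    if "\<And>a b. a \<in> {Suc l..l + Suc k} \<Longrightarrow> b \<in> {1..n} \<Longrightarrow> u i c f (a, b) = u i c' g (a, b)"
    for i c c' f g
  proof -
    have "G_from n (\<lambda>a b. u i c f (a, b)) l x (Suc k) = G_from n (\<lambda>a b. u i c' g (a, b)) l x (Suc k)"
      by (rule G_from_cong) (use that in auto)
    then show ?thesis by (simp add: E_def)
  qed
  have x_mono: "x $ a \<le> x $ b" if "a \<le> b" "b < n" for a b
    using Suc.prems that by (auto simp: W_def)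
  have "prob {\<omega> \<in> space M. E i c (\<lambda>p. X p \<omega>)} = mixed_det q k n y i (next_col x c) (t i c)"
    if "i \<le> n" for i c
    using that
  proof (induction i arbitrary: c rule: inc_induct)
    case base
    have "E n c f \<longleftrightarrow> G_from n (\<lambda>a b. f (a, b)) (Suc l) (vec n (next_col x c)) k = y" for f
    proof -
      have "vec n (next_col x (\<lambda>b. u n c f (Suc l, b))) = vec n (next_col x c)"
        by (intro eq_vecI) (auto intro!: next_col_cong simp: u_def)
      moreover have "G_from n (\<lambda>a b. u n c f (a, b)) (Suc l) z k = G_from n (\<lambda>a b. f (a, b)) (Suc l) z k" for z
        by (rule G_from_cong) (simp add: u_def)
      ultimately show ?thesis
        unfolding E_def G_from_Suc_start by simp
    qed
    then have "prob {\<omega> \<in> space M. E n c (\<lambda>p. X p \<omega>)} = transition_det q n k (vec n (next_col x c)) y"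
      using Suc.IH[OF next_col_W, of "Suc l" x c] by simp
    also have "\<dots> = mixed_det q k n y n (next_col x c) (t n c)"
      unfolding transition_det_def mixed_det_def
      by (rule arg_cong[where f = det]) (auto intro!: eq_matI)
    finally show ?case .
  next
    case (step i)
    define z where "z = t i c i"
    have next_i: "next_col x (c(Suc i := v)) i = z + int v" for v
    proof (cases i)
      case (Suc i')
      have "next_col x (c(Suc i := v)) i' = next_col x c i'"
        by (rule next_col_cong) (auto simp: Suc)
      then show ?thesis by (simp add: z_def t_def Suc)
    qed (simp add: z_def t_def)
    have next_less: "next_col x (c(Suc i := v)) a = next_col x c a" if "a < i" for a v
      by (rule next_col_cong) (use that in auto)
    have "(\<lambda>v. prob {\<omega> \<in> space M. X (Suc l, Suc i) \<omega> = v} *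
        prob {\<omega> \<in> space M. E i c ((\<lambda>p. X p \<omega>)((Suc l, Suc i) := v))})
        sums prob {\<omega> \<in> space M. E i c (\<lambda>p. X p \<omega>)}"
      by (rule prob_condition_on_coordinate[OF ind, where J = "{Suc l..l + Suc k} \<times> {1..n}"])
        (auto intro!: E_cong simp: u_def)
    moreover have "prob {\<omega> \<in> space M. X (Suc l, Suc i) \<omega> = v} = (1 - q) * q ^ v" for v
      by (rule geo) simp
    moreover have "prob {\<omega> \<in> space M. E i c ((\<lambda>p. X p \<omega>)((Suc l, Suc i) := v))} =
        mixed_det q k n y (Suc i) ((next_col x c)(i := z + int v)) (\<lambda>a. max (x $ a) (z + int v))" for v
    proof -
      have "u i c (f((Suc l, Suc i) := v)) = u (Suc i) (c(Suc i := v)) f" for f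
        by (auto simp: u_def fun_eq_iff le_Suc_eq)
      then have "prob {\<omega> \<in> space M. E i c ((\<lambda>p. X p \<omega>)((Suc l, Suc i) := v))} =
          prob {\<omega> \<in> space M. E (Suc i) (c(Suc i := v)) (\<lambda>p. X p \<omega>)}"
        by (simp add: E_def)
      also have "\<dots> = mixed_det q k n y (Suc i) (next_col x (c(Suc i := v))) (t (Suc i) (c(Suc i := v)))"
        by (rule step.IH)
      also have "\<dots> = mixed_det q k n y (Suc i) ((next_col x c)(i := z + int v)) (\<lambda>a. max (x $ a) (z + int v))"
        by (rule mixed_det_cong) (auto simp: t_def next_i next_less less_Suc_eq)
      finally show ?thesis .
    qed
    ultimately have "(\<lambda>v. (1 - q) * q ^ v * mixed_det q k n y (Suc i)
        ((next_col x c)(i := z + int v)) (\<lambda>a. max (x $ a) (z + int v)))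
        sums prob {\<omega> \<in> space M. E i c (\<lambda>p. X p \<omega>)}"
      by simp
    moreover have "(\<lambda>v. (1 - q) * q ^ v * mixed_det q k n y (Suc i)
        ((next_col x c)(i := z + int v)) (\<lambda>a. max (x $ a) (z + int v)))
        sums mixed_det q k n y i (next_col x c) ((\<lambda>a. max (x $ a) z)(i := z))"
      by (rule mixed_det_sums[OF q step.hyps(2)]) (rule x_mono)
    ultimately have "prob {\<omega> \<in> space M. E i c (\<lambda>p. X p \<omega>)} =
        mixed_det q k n y i (next_col x c) ((\<lambda>a. max (x $ a) z)(i := z))"
      by (rule sums_unique2)
    also have "\<dots> = mixed_det q k n y i (next_col x c) (t i c)"
    proof (rule mixed_det_cong)
      fix a assume a: "i \<le> a" "a < n"
      then show "((\<lambda>a. max (x $ a) z)(i := z)) a = t i c a"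
        \<comment> \<open>Pushing by \<open>x\<^sub>i\<close> has no effect on \<open>x\<^sub>a \<ge> x\<^sub>i\<close>.\<close>
        using x_mono[OF a] by (auto simp: z_def t_def)
    qed simp
    finally show ?case .
  qed
  from this[of 0 "\<lambda>_. 0"]
  have "prob {\<omega> \<in> space M. E 0 (\<lambda>_. 0) (\<lambda>p. X p \<omega>)} = transition_det q n (Suc k) x y"
    by (simp add: transition_det_def mixed_det_def t_def)
  moreover have "G_from n (\<lambda>a b. u 0 (\<lambda>_. 0) f (a, b)) l x (Suc k) = G_from n (\<lambda>a b. f (a, b)) l x (Suc k)" for f
    by (rule G_from_cong) (simp add: u_def)
  ultimately show ?case
    unfolding E_def by simp
qed

theorem theorem2p1:
  fixes M :: "'a measure" and w :: "nat \<Rightarrow> nat \<Rightarrow> 'a \<Rightarrow> nat"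
    and q :: real and n l m :: nat and x y :: "int vec"
  assumes "prob_space M"
    and "0 < q" and "q < 1"
    and "n \<ge> 1"
    and indep: "prob_space.indep_vars M (\<lambda>_. count_space UNIV) (\<lambda>(i, j). w i j)
                  {(i, j). i \<ge> 1 \<and> j \<ge> 1}"
    and geometric: "\<And>i j k. i \<ge> 1 \<Longrightarrow> j \<ge> 1 \<Longrightarrow>
                  measure M {\<omega> \<in> space M. w i j \<omega> = k} = (1 - q) * q ^ k"
    and "x \<in> W n" and "y \<in> W n"
    and "l \<le> m"
  defines "G \<equiv> \<lambda>i \<omega>. G_vec n (\<lambda>i j. w i j \<omega>) i"
    and "D \<equiv> det (mat n n (\<lambda>(i, j).
                  diff_pow (int j - int i) (w_conv q (m - l)) (y $ j - x $ i)))"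
  shows "(measure M {\<omega> \<in> space M. G l \<omega> = x} > 0 \<longrightarrow>
            cond_prob M (\<lambda>\<omega>. G m \<omega> = y) (\<lambda>\<omega>. G l \<omega> = x) = D) \<and>
         measure M {\<omega> \<in> space M. G_from n (\<lambda>i j. w i j \<omega>) l x (m - l) = y} = D"
proof -
  interpret prob_space M by (rule assms(1))
  define X where "X = (\<lambda>(i, j). w i j)"
  have w: "w i j \<omega> = X (i, j) \<omega>" for i j \<omega>
    by (simp add: X_def)
  have I: "{(i, j). i \<ge> 1 \<and> j \<ge> 1} = ({1..} \<times> {1..} :: (nat \<times> nat) set)"
    by auto
  have ind: "indep_vars (\<lambda>_. count_space UNIV) X ({1..} \<times> {1..})"
    using indep unfolding I X_def .
  have D: "D = transition_det q n (m - l) x y"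
    by (simp add: D_def transition_det_def kernel_entry_def)
  have from_x: "prob {\<omega> \<in> space M. G_from n (\<lambda>i j. X (i, j) \<omega>) l x (m - l) = y} = D"
    unfolding D
    by (rule prob_G_from[OF \<open>0 < q\<close> \<open>q < 1\<close> ind _ \<open>x \<in> W n\<close> \<open>y \<in> W n\<close>])
      (auto simp: X_def geometric)
  have G_m: "G m \<omega> = G_from n (\<lambda>i j. X (i, j) \<omega>) l (G l \<omega>) (m - l)" for \<omega>
    using G_vec_add[of n "\<lambda>i j. X (i, j) \<omega>" l "m - l"] \<open>l \<le> m\<close> by (simp add: G_def w)
  have G_l: "G l \<omega> = G_vec n (\<lambda>i j. X (i, j) \<omega>) l" for \<omega>
    by (simp add: G_def w)
  have "prob {\<omega> \<in> space M. G_from n (\<lambda>i j. X (i, j) \<omega>) l x (m - l) = y \<and> G_vec n (\<lambda>i j. X (i, j) \<omega>) l = x} =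
      prob {\<omega> \<in> space M. G_from n (\<lambda>i j. X (i, j) \<omega>) l x (m - l) = y} *
      prob {\<omega> \<in> space M. G_vec n (\<lambda>i j. X (i, j) \<omega>) l = x}"
  proof (rule prob_disjoint_dependence[OF ind, where A = "{Suc l..m} \<times> {1..n}"
        and B = "{1..l} \<times> {1..n}" and P = "\<lambda>f. G_from n (\<lambda>i j. f (i, j)) l x (m - l) = y"
        and Q = "\<lambda>f. G_vec n (\<lambda>i j. f (i, j)) l = x"])
    fix f g :: "nat \<times> nat \<Rightarrow> nat"
    assume "\<And>p. p \<in> {Suc l..m} \<times> {1..n} \<Longrightarrow> f p = g p"
    then have "G_from n (\<lambda>i j. f (i, j)) l x (m - l) = G_from n (\<lambda>i j. g (i, j)) l x (m - l)"
      by (intro G_from_cong) auto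
    then show "(G_from n (\<lambda>i j. f (i, j)) l x (m - l) = y) =
        (G_from n (\<lambda>i j. g (i, j)) l x (m - l) = y)" by simp
  next
    fix f g :: "nat \<times> nat \<Rightarrow> nat"
    assume "\<And>p. p \<in> {1..l} \<times> {1..n} \<Longrightarrow> f p = g p"
    then have "G_vec n (\<lambda>i j. f (i, j)) l = G_vec n (\<lambda>i j. g (i, j)) l"
      by (intro G_vec_cong) auto
    then show "(G_vec n (\<lambda>i j. f (i, j)) l = x) = (G_vec n (\<lambda>i j. g (i, j)) l = x)" by simp
  next
    show "{Suc l..m} \<times> {1..n} \<inter> {1..l} \<times> {1..n} = {}" by fastforce
  next
    show "{Suc l..m} \<times> {1..n} \<subseteq> {1..} \<times> {1..}" by (intro Sigma_mono) auto
  next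
    show "{1..l} \<times> {1..n} \<subseteq> {1..} \<times> {1..}" by (intro Sigma_mono) auto
  qed simp_all
  then have "prob {\<omega> \<in> space M. G_from n (\<lambda>i j. X (i, j) \<omega>) l x (m - l) = y \<and> G l \<omega> = x} =
      D * prob {\<omega> \<in> space M. G l \<omega> = x}"
    unfolding from_x G_l .
  moreover have "{\<omega> \<in> space M. G m \<omega> = y \<and> G l \<omega> = x} =
      {\<omega> \<in> space M. G_from n (\<lambda>i j. X (i, j) \<omega>) l x (m - l) = y \<and> G l \<omega> = x}"
    using G_m by (intro Collect_cong) metis
  ultimately have joint: "prob {\<omega> \<in> space M. G m \<omega> = y \<and> G l \<omega> = x} =
      D * prob {\<omega> \<in> space M. G l \<omega> = x}"
    by simp
  show ?thesis
  proof (intro conjI impI)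
    assume "prob {\<omega> \<in> space M. G l \<omega> = x} > 0"
    then show "cond_prob M (\<lambda>\<omega>. G m \<omega> = y) (\<lambda>\<omega>. G l \<omega> = x) = D"
      unfolding cond_prob_def joint by simp
  next
    show "prob {\<omega> \<in> space M. G_from n (\<lambda>i j. w i j \<omega>) l x (m - l) = y} = D"
      using from_x unfolding w .
  qed
qed

end
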